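(* Let $n\geq 2$ be an integer and let $R$ be a ring with property $\mathrm{L}_n$ (that is, Lie nilpotent of index $n$). Then: \begin{enumerate} \item If $P$ is a prime (two-sided) ideal of $R$ and $a,b\in R$ satisfy $ab\in P$, then $a\in P$ or $b\in P$. In other words, all prime ideals of $R$ are completely prime. \item The prime radical of $R$ is the set of all nilpotent elements: $\mathrm{rad}(R)=\{u\in R\mid u^k=0\text{ for some }k\geq 1\}$. \item The factor ring $R/\mathrm{rad}(R)$ is commutative. \item If $L$ is a left ideal of $R$, then $L+\mathrm{rad}(R)$ is a two-sided ideal of $R$. In particular, all left ideals of $R$ containing $\mathrm{rad}(R)$ are two-sided ideals. \end{enumerate}
   Context: Rings are associative. For elements $x,y$ of a ring, $[x,y]=xy-yx$. Left normed commutators are defined by $[x_1]_1^*=x_1$ and $[x_1,\ldots,x_{k+1}]_{k+1}^*=[[x_1,\ldots,x_k]_k^*,x_{k+1}]$. A ring $R$ is Lie nilpotent of index $n$ (has property $\mathrm{L}_n$) if $[x_1,\ldots,x_{n+1}]_{n+1}^*=0$ for all $x_1,\ldots,x_{n+1}\in R$. A prime ideal is a proper two-sided ideal $P$ such that for two-sided ideals $A,B$, $AB\subseteq P$ implies $A\subseteq P$ or $B\subseteq P$. $\mathrm{rad}(R)$ denotes the prime (lower nil) radical of $R$, i.e. the intersection of all prime ideals of $R$ (equal to $R$ if there are none). *)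

theory Defs
  imports Main "HOL-Library.Set_Algebras"
begin

text \<open>
  A ring is a type of class \<open>ring\<close>: associative, with no identity element required. This rules
  out the library's \<open>u ^ k\<close>, which needs \<open>1\<close>, and the ideals and quotients of HOL-Algebra,
  whose locale \<open>ring\<close> is unital.
\<close>

definition lie_bracket :: "'a::ring \<Rightarrow> 'a \<Rightarrow> 'a" where
  "lie_bracket x y = x * y - y * x"

text \<open>
  \<open>left_normed_commutator k x\<close> is $[x_1,\ldots,x_k]_k^*$, where \<open>x i\<close> is $x_i$. The value at
  \<open>k = 0\<close> is a dummy.
\<close>

fun left_normed_commutator :: "nat \<Rightarrow> (nat \<Rightarrow> 'a::ring) \<Rightarrow> 'a" where
  "left_normed_commutator 0 x = 0"
| "left_normed_commutator (Suc 0) x = x 1"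
| "left_normed_commutator (Suc (Suc k)) x =
     lie_bracket (left_normed_commutator (Suc k) x) (x (Suc (Suc k)))"

definition lie_nilpotent :: "'a::ring itself \<Rightarrow> nat \<Rightarrow> bool" where
  "lie_nilpotent _ n \<longleftrightarrow> (\<forall>x :: nat \<Rightarrow> 'a. left_normed_commutator (n + 1) x = 0)"

definition add_subgroup :: "'a::ring set \<Rightarrow> bool" where
  "add_subgroup A \<longleftrightarrow> 0 \<in> A \<and> (\<forall>x\<in>A. \<forall>y\<in>A. x + y \<in> A) \<and> (\<forall>x\<in>A. - x \<in> A)"

definition left_ideal :: "'a::ring set \<Rightarrow> bool" where
  "left_ideal L \<longleftrightarrow> add_subgroup L \<and> (\<forall>r. \<forall>x\<in>L. r * x \<in> L)"

definition two_sided_ideal :: "'a::ring set \<Rightarrow> bool" where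
  "two_sided_ideal I \<longleftrightarrow> add_subgroup I \<and> (\<forall>r. \<forall>x\<in>I. r * x \<in> I \<and> x * r \<in> I)"

text \<open>
  The product of ideals consists of finite sums of products; the operation \<open>A * B\<close> on sets from
  \<open>Set_Algebras\<close> contains only the products themselves.
\<close>

definition ideal_prod :: "'a::ring set \<Rightarrow> 'a set \<Rightarrow> 'a set" where
  "ideal_prod A B =
     {(\<Sum>i<k. a i * b i) | (k::nat) a b. \<forall>i<k. a i \<in> A \<and> b i \<in> B}"

definition prime_ideal :: "'a::ring set \<Rightarrow> bool" where
  "prime_ideal P \<longleftrightarrow> two_sided_ideal P \<and> P \<noteq> UNIV \<and>
     (\<forall>A B. two_sided_ideal A \<longrightarrow> two_sided_ideal B \<longrightarrow> ideal_prod A B \<subseteq> P \<longrightarrow> A \<subseteq> P \<or> B \<subseteq> P)"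

definition prime_radical :: "'a::ring set" where
  "prime_radical = \<Inter> {P. prime_ideal P}"

text \<open>
  \<open>pos_pow u k\<close> is $u^k$ for \<open>k \<ge> 1\<close>; the value at \<open>k = 0\<close> is a dummy.
\<close>

fun pos_pow :: "'a::ring \<Rightarrow> nat \<Rightarrow> 'a" where
  "pos_pow u 0 = 0"
| "pos_pow u (Suc 0) = u"
| "pos_pow u (Suc (Suc k)) = pos_pow u (Suc k) * u"

lemma pos_pow_eq_power:
  fixes u :: "'a::ring_1"
  assumes "k \<ge> 1"
  shows "pos_pow u k = u ^ k"
  using assms by (induction u k rule: pos_pow.induct) (auto simp: power_commutes mult.assoc)

definition nilpotent_elem :: "'a::ring \<Rightarrow> bool" where
  "nilpotent_elem u \<longleftrightarrow> (\<exists>k\<ge>1. pos_pow u k = 0)"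

text \<open>
  The factor ring by \<open>I\<close> has the cosets \<open>x +o I\<close> as elements, and its multiplication is given
  on sets of representatives, as in \<open>rcoset_mult\<close> of HOL-Algebra. By \<open>coset_mult_cosets\<close>
  it is $(x + I)(y + I) = xy + I$.
\<close>

definition factor_ring_carrier :: "'a::ring set \<Rightarrow> 'a set set" where
  "factor_ring_carrier I = range (\<lambda>x. x +o I)"

definition coset_mult :: "'a::ring set \<Rightarrow> 'a set \<Rightarrow> 'a set \<Rightarrow> 'a set" where
  "coset_mult I X Y = (\<Union>x\<in>X. \<Union>y\<in>Y. (x * y) +o I)"

definition factor_ring_commutative :: "'a::ring set \<Rightarrow> bool" where
  "factor_ring_commutative I \<longleftrightarrow>
     (\<forall>X\<in>factor_ring_carrier I. \<forall>Y\<in>factor_ring_carrier I. coset_mult I X Y = coset_mult I Y X)"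

lemma coset_mult_cosets:
  fixes I :: "'a::ring set"
  assumes "two_sided_ideal I"
  shows "coset_mult I (x +o I) (y +o I) = (x * y) +o I"
proof -
  have zero: "0 \<in> I" and add: "\<And>u v. u \<in> I \<Longrightarrow> v \<in> I \<Longrightarrow> u + v \<in> I"
    and l: "\<And>r u. u \<in> I \<Longrightarrow> r * u \<in> I" and r: "\<And>r u. u \<in> I \<Longrightarrow> u * r \<in> I"
    using assms by (auto simp: two_sided_ideal_def add_subgroup_def)
  show ?thesis
  proof
    show "coset_mult I (x +o I) (y +o I) \<subseteq> (x * y) +o I"
    proof
      fix z assume "z \<in> coset_mult I (x +o I) (y +o I)"
      then obtain a b c where abc: "a \<in> I" "b \<in> I" "c \<in> I" "z = (x + a) * (y + b) + c"
        by (auto simp: coset_mult_def elt_set_plus_def)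
      have "z = x * y + (x * b + (a * y + (a * b + c)))"
        using abc(4) by (simp add: algebra_simps)
      moreover have "x * b + (a * y + (a * b + c)) \<in> I"
        using abc by (intro add l r)
      ultimately show "z \<in> (x * y) +o I" by (auto simp: elt_set_plus_def)
    qed
    have "x \<in> x +o I" "y \<in> y +o I"
      using zero by (auto simp: elt_set_plus_def intro!: bexI[of _ 0])
    then show "(x * y) +o I \<subseteq> coset_mult I (x +o I) (y +o I)"
      unfolding coset_mult_def by blast
  qed
qed

lemma two_sided_ideal_prime_radical: "two_sided_ideal prime_radical"
  by (auto simp: prime_radical_def prime_ideal_def two_sided_ideal_def add_subgroup_def)

end

theory Submission
  imports Defs
begin

text \<open>
  If \<open>[d, y]\<close> is central modulo a prime ideal \<open>P\<close> for all \<open>y\<close>, then so is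
  \<open>[d, d y] = d [d, y]\<close>, and expanding \<open>[d [d, y], y]\<close> gives \<open>[d, y] [d, y] \<in> P\<close>. A central
  element of square zero vanishes in a prime ring, hence \<open>[d, y] \<in> P\<close>. So the length of the
  commutators known to lie in \<open>P\<close> can be lowered down to 2, i.e. the factor ring by a prime ideal
  is commutative, and a commutative prime ring has no zero divisors. That non-nilpotent elements
  avoid some prime ideal is the usual application of Zorn's lemma to the ideals disjoint from
  the powers of the element.
\<close>

section \<open>Ideals, their sums and products\<close>

lemma two_sided_idealD:
  assumes "two_sided_ideal I"
  shows "0 \<in> I" "x \<in> I \<Longrightarrow> y \<in> I \<Longrightarrow> x + y \<in> I" "x \<in> I \<Longrightarrow> - x \<in> I"
    "x \<in> I \<Longrightarrow> y \<in> I \<Longrightarrow> x - y \<in> I" "x \<in> I \<Longrightarrow> r * x \<in> I" "x \<in> I \<Longrightarrow> x * r \<in> I"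
proof -
  show "0 \<in> I" "x \<in> I \<Longrightarrow> y \<in> I \<Longrightarrow> x + y \<in> I" "x \<in> I \<Longrightarrow> - x \<in> I"
    "x \<in> I \<Longrightarrow> r * x \<in> I" "x \<in> I \<Longrightarrow> x * r \<in> I"
    using assms by (auto simp: two_sided_ideal_def add_subgroup_def)
  have "x + - y \<in> I" if "x \<in> I" "y \<in> I"
    using assms that unfolding two_sided_ideal_def add_subgroup_def by blast
  then show "x \<in> I \<Longrightarrow> y \<in> I \<Longrightarrow> x - y \<in> I" by simp
qed

lemma add_subgroup_plus:
  assumes "add_subgroup A" "add_subgroup B"
  shows "add_subgroup (A + B)"
  unfolding add_subgroup_def
proof (intro conjI ballI)
  show "0 \<in> A + B"
    using set_plus_intro[of 0 A 0 B] assms by (simp add: add_subgroup_def)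
next
  fix x y assume "x \<in> A + B" "y \<in> A + B"
  then obtain a b a' b' where "a \<in> A" "b \<in> B" "a' \<in> A" "b' \<in> B" "x = a + b" "y = a' + b'"
    by (auto elim!: set_plus_elim)
  then have "a + a' \<in> A" "b + b' \<in> B" "x + y = (a + a') + (b + b')"
    using assms by (auto simp: add_subgroup_def algebra_simps)
  then show "x + y \<in> A + B" by (simp add: set_plus_intro)
next
  fix x assume "x \<in> A + B"
  then obtain a b where "a \<in> A" "b \<in> B" "x = a + b" by (auto elim!: set_plus_elim)
  then have "- a \<in> A" "- b \<in> B" "- x = - a + - b"
    using assms by (auto simp: add_subgroup_def)
  then show "- x \<in> A + B" by (metis set_plus_intro)
qed

lemma two_sided_ideal_plus:
  assumes "two_sided_ideal A" "two_sided_ideal B"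
  shows "two_sided_ideal (A + B)"
  using assms add_subgroup_plus
  by (auto simp: two_sided_ideal_def distrib_left distrib_right elim!: set_plus_elim
      intro!: set_plus_intro)

lemma ideal_prod_subsetI:
  assumes "two_sided_ideal P" and "\<And>a b. a \<in> A \<Longrightarrow> b \<in> B \<Longrightarrow> a * b \<in> P"
  shows "ideal_prod A B \<subseteq> P"
proof
  fix z assume "z \<in> ideal_prod A B"
  then obtain k :: nat and a b
    where z: "z = (\<Sum>i<k. a i * b i)" and ab: "\<forall>i<k. a i \<in> A \<and> b i \<in> B"
    by (auto simp: ideal_prod_def)
  from ab have "(\<Sum>i<k. a i * b i) \<in> P"
    using assms by (induction k) (auto intro: two_sided_idealD)
  then show "z \<in> P" by (simp add: z)
qed

lemma mult_in_ideal_prod: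
  assumes "a \<in> A" "b \<in> B"
  shows "a * b \<in> ideal_prod A B"
proof -
  have "a * b = (\<Sum>i<1::nat. a * b)" by simp
  then show ?thesis
    using assms unfolding ideal_prod_def
    by (intro CollectI exI[of _ "1::nat"] exI[of _ "\<lambda>_. a"] exI[of _ "\<lambda>_. b"]) simp
qed

section \<open>Central elements modulo a prime ideal\<close>

lemma prime_ideal_two_sided: "prime_ideal P \<Longrightarrow> two_sided_ideal P"
  by (simp add: prime_ideal_def)

text \<open>Centrality modulo \<open>P\<close> turns \<open>c * d \<in> P\<close> into
  \<open>c * r * d \<in> P\<close> for all \<open>r\<close>, so \<open>c\<close> annihilates modulo
  \<open>P\<close> the whole ideal generated by \<open>d\<close>. Primeness is then applied to two
  mutually annihilating ideals, one containing \<open>c\<close> and the other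
  \<open>d\<close>.\<close>

lemma prime_ideal_central:
  assumes P: "prime_ideal P"
    and central: "\<And>r. lie_bracket c r \<in> P"
    and cd: "c * d \<in> P"
  shows "c \<in> P \<or> d \<in> P"
proof -
  note tsi = prime_ideal_two_sided[OF P] and I = two_sided_idealD[OF prime_ideal_two_sided[OF P]]
  \<comment> \<open>The elements annihilating the ideal generated by \<open>d\<close>, without mentioning generators:
    in the absence of an identity, \<open>x d\<close> and \<open>x r d\<close> are separate conditions.\<close>
  define A where "A = {x. x * d \<in> P \<and> (\<forall>r. x * r * d \<in> P)}"
  \<comment> \<open>The right annihilator of \<open>A\<close> modulo \<open>P\<close>. It absorbs
    left factors because \<open>A\<close> absorbs right ones, and the first condition in
    \<open>A\<close> puts \<open>d\<close> into it.\<close>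
  define B where "B = {y. \<forall>x\<in>A. x * y \<in> P}"
  have A: "two_sided_ideal A"
    unfolding two_sided_ideal_def add_subgroup_def
  proof (intro conjI ballI allI)
    show "0 \<in> A" "\<And>x y. x \<in> A \<Longrightarrow> y \<in> A \<Longrightarrow> x + y \<in> A" "\<And>x. x \<in> A \<Longrightarrow> - x \<in> A"
      using I by (auto simp: A_def distrib_right)
    show "r * x \<in> A" if "x \<in> A" for r x
      using that I by (auto simp: A_def mult.assoc)
    show "x * r \<in> A" if "x \<in> A" for r x
    proof -
      have "x * r * s * d \<in> P" for s
        using that by (simp add: A_def mult.assoc[of x r s])
      then show ?thesis using that by (simp add: A_def)
    qed
  qed
  have B: "two_sided_ideal B"
    unfolding two_sided_ideal_def add_subgroup_def
  proof (intro conjI ballI allI)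
    show "0 \<in> B" "\<And>x y. x \<in> B \<Longrightarrow> y \<in> B \<Longrightarrow> x + y \<in> B" "\<And>x. x \<in> B \<Longrightarrow> - x \<in> B"
      using I by (auto simp: B_def distrib_left)
    show "r * y \<in> B" "y * r \<in> B" if "y \<in> B" for r y
      using that I two_sided_idealD(6)[OF A]
      by (auto simp: B_def mult.assoc[symmetric])
  qed
  have "ideal_prod A B \<subseteq> P"
    by (rule ideal_prod_subsetI[OF tsi]) (auto simp: B_def)
  then have "A \<subseteq> P \<or> B \<subseteq> P"
    using P A B by (simp add: prime_ideal_def)
  moreover have "c \<in> A"
  proof -
    have "c * r * d \<in> P" for r
    proof -
      have "c * r * d = lie_bracket c r * d + r * (c * d)"
        by (simp add: lie_bracket_def algebra_simps)
      then show ?thesis using central cd I by simp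
    qed
    then show ?thesis using cd by (simp add: A_def)
  qed
  moreover have "d \<in> B" by (simp add: A_def B_def)
  ultimately show ?thesis by blast
qed

section \<open>Commutators modulo a prime ideal\<close>

lemma left_normed_commutator_cong:
  assumes "\<And>i. 1 \<le> i \<Longrightarrow> i \<le> k \<Longrightarrow> x i = y i"
  shows "left_normed_commutator k x = left_normed_commutator k y"
  using assms by (induction k x rule: left_normed_commutator.induct) auto

lemma prime_ideal_commutator_step:
  fixes P :: "'a::ring set"
  assumes P: "prime_ideal P"
    and central: "\<And>y z. lie_bracket (lie_bracket d y) z \<in> P"
  shows "lie_bracket d y \<in> P"
proof -
  note I = two_sided_idealD[OF prime_ideal_two_sided[OF P]]
  let ?c = "lie_bracket d y"
  \<comment> \<open>Since \<open>[d, d y] = d c\<close>, the outer bracket is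
    \<open>[d c, y]\<close>, which the Leibniz rule expands to
    \<open>c c + d [c, y]\<close>.\<close>
  have "?c * ?c = lie_bracket (lie_bracket d (d * y)) y - d * lie_bracket ?c y"
    by (simp add: lie_bracket_def algebra_simps)
  then have "?c * ?c \<in> P" using central I by simp
  with prime_ideal_central[OF P central] show ?thesis by blast
qed

text \<open>Induction on the length, which is \<open>k + 2\<close> so that the base case is a single
  bracket. The commutator of the first \<open>k + 1\<close> entries serves as the \<open>d\<close>
  of the previous lemma.\<close>

lemma prime_ideal_left_normed_commutator:
  fixes P :: "'a::ring set"
  assumes P: "prime_ideal P"
    and "\<And>x. left_normed_commutator (Suc (Suc k)) x \<in> P"
  shows "lie_bracket a b \<in> P"
  using assms(2)
proof (induction k)
  case 0
  from 0[of "\<lambda>i. if i = 1 then a else b"] show ?case by simp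
next
  case (Suc k)
  have "left_normed_commutator (Suc (Suc k)) x \<in> P" for x :: "nat \<Rightarrow> 'a"
  proof -
    let ?d = "left_normed_commutator (Suc k) x"
    have "lie_bracket (lie_bracket ?d y) z \<in> P" for y z
    proof -
      \<comment> \<open>The inner commutator does not see the last two entries, so these can be
        prescribed freely.\<close>
      let ?x = "x(Suc (Suc k) := y, Suc (Suc (Suc k)) := z)"
      have "left_normed_commutator (Suc k) ?x = ?d"
        by (rule left_normed_commutator_cong) auto
      then have "left_normed_commutator (Suc (Suc (Suc k))) ?x
          = lie_bracket (lie_bracket ?d y) z"
        unfolding left_normed_commutator.simps by simp
      then show ?thesis using Suc.prems[of ?x] by metis
    qed
    then show ?thesis using prime_ideal_commutator_step[OF P] by simp
  qed
  then show ?case by (rule Suc.IH)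
qed

lemma prime_ideal_commutator:
  fixes P :: "'a::ring set"
  assumes "n \<ge> 1" "lie_nilpotent TYPE('a) n" "prime_ideal P"
  shows "lie_bracket a b \<in> P"
proof -
  \<comment> \<open>Property \<open>L_n\<close> concerns commutators of length \<open>n + 1\<close>,
    that is \<open>k + 2\<close>.\<close>
  obtain k where "n = Suc k" using assms(1) by (cases n) auto
  with assms(2) have "left_normed_commutator (Suc (Suc k)) x \<in> P" for x
    using two_sided_idealD(1)[OF prime_ideal_two_sided[OF assms(3)]]
    by (simp add: lie_nilpotent_def del: left_normed_commutator.simps)
  then show ?thesis by (rule prime_ideal_left_normed_commutator[OF assms(3)])
qed

section \<open>Prime ideals avoiding a multiplicative set\<close>

lemma ex_prime_ideal_disjoint:
  fixes S :: "'a::ring set"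
  assumes "S \<noteq> {}" "0 \<notin> S" and mult: "\<And>s t. s \<in> S \<Longrightarrow> t \<in> S \<Longrightarrow> s * t \<in> S"
  obtains P where "prime_ideal P" "P \<inter> S = {}"
proof -
  define F where "F = {I. two_sided_ideal I \<and> I \<inter> S = {}}"
  have "{0} \<in> F"
    using assms by (auto simp: F_def two_sided_ideal_def add_subgroup_def)
  have chain: "\<Union>C \<in> F" if "C \<noteq> {}" and C: "subset.chain F C" for C
  proof -
    have CF: "C \<subseteq> F" and total: "\<And>X Y. X \<in> C \<Longrightarrow> Y \<in> C \<Longrightarrow> X \<subseteq> Y \<or> Y \<subseteq> X"
      using C by (auto simp: subset_chain_def)
    have C_ideal: "two_sided_ideal X" if "X \<in> C" for X
      using that CF by (auto simp: F_def)
    have "x + y \<in> \<Union>C" if xy: "x \<in> X" "X \<in> C" "y \<in> Y" "Y \<in> C" for x y X Y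
    proof -
      from total[OF xy(2,4)] obtain Z where "Z \<in> C" "x \<in> Z" "y \<in> Z" using xy by blast
      then show ?thesis using two_sided_idealD(2)[OF C_ideal] by blast
    qed
    moreover have "0 \<in> \<Union>C"
      using \<open>C \<noteq> {}\<close> two_sided_idealD(1)[OF C_ideal] by blast
    ultimately have "two_sided_ideal (\<Union>C)"
      unfolding two_sided_ideal_def add_subgroup_def
      by (auto intro: two_sided_idealD[OF C_ideal])
    then show ?thesis using CF by (auto simp: F_def)
  qed
  obtain P where PF: "P \<in> F" and max: "\<And>I. I \<in> F \<Longrightarrow> P \<subseteq> I \<Longrightarrow> I = P"
    using subset_Zorn_nonempty[of F] \<open>{0} \<in> F\<close> chain by blast
  have P: "two_sided_ideal P" "P \<inter> S = {}" using PF by (auto simp: F_def)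
  note I = two_sided_idealD[OF P(1)]
  \<comment> \<open>By maximality of \<open>P\<close>, the strictly larger ideal
    \<open>A + P\<close> cannot avoid \<open>S\<close>.\<close>
  have meets: "\<exists>a\<in>A. \<exists>p\<in>P. a + p \<in> S" if A: "two_sided_ideal A" "\<not> A \<subseteq> P" for A
  proof -
    have "P \<subseteq> A + P" "A \<subseteq> A + P"
      using set_plus_intro[of 0 A _ P] set_plus_intro[of _ A 0 P] I(1) two_sided_idealD(1)[OF A(1)]
      by auto
    then have "A + P \<notin> F" using max A(2) by blast
    then have "(A + P) \<inter> S \<noteq> {}"
      using two_sided_ideal_plus[OF A(1) P(1)] by (simp add: F_def)
    then show ?thesis by (auto elim!: set_plus_elim)
  qed
  have "A \<subseteq> P \<or> B \<subseteq> P"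
    if AB: "two_sided_ideal A" "two_sided_ideal B" "ideal_prod A B \<subseteq> P" for A B
  proof (rule ccontr)
    assume "\<not> (A \<subseteq> P \<or> B \<subseteq> P)"
    then obtain a p b q where *: "a \<in> A" "p \<in> P" "a + p \<in> S" "b \<in> B" "q \<in> P" "b + q \<in> S"
      using meets AB(1,2) by blast
    have "a * b \<in> P" using mult_in_ideal_prod * AB(3) by blast
    \<comment> \<open>Apart from \<open>a * b\<close>, every summand has a factor in
      \<open>P\<close>; the product of two elements of \<open>S\<close> thus falls into
      \<open>P\<close>.\<close>
    moreover have "(a + p) * (b + q) = a * b + (a * q + p * (b + q))"
      by (simp add: algebra_simps)
    ultimately have "(a + p) * (b + q) \<in> P"
      using * I by simp
    then show False using mult * P(2) by blast
  qed
  moreover have "P \<noteq> UNIV" using P(2) \<open>S \<noteq> {}\<close> by blast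
  ultimately have "prime_ideal P" using P(1) by (simp add: prime_ideal_def)
  then show ?thesis using that P(2) by blast
qed

section \<open>Nilpotent elements and the prime radical\<close>

text \<open>This makes the powers of \<open>u\<close> a multiplicative set. Exponents are successors
  because \<open>pos_pow u 0\<close> is the dummy 0, for which the power law fails.\<close>

lemma pos_pow_mult:
  "pos_pow u (Suc i) * pos_pow u (Suc j) = pos_pow u (Suc (Suc (i + j)))"
  by (induction j) (auto simp: mult.assoc[symmetric])

lemma prime_radical_nilpotent:
  assumes "u \<in> prime_radical"
  shows "nilpotent_elem u"
proof (rule ccontr)
  assume u: "\<not> nilpotent_elem u"
  let ?S = "range (\<lambda>i. pos_pow u (Suc i))"
  have "0 \<notin> ?S" using u by (force simp: nilpotent_elem_def)
  moreover have "s * t \<in> ?S" if "s \<in> ?S" "t \<in> ?S" for s t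
    using that pos_pow_mult[of u] by (auto simp del: pos_pow.simps)
  ultimately obtain P where "prime_ideal P" "P \<inter> ?S = {}"
    using ex_prime_ideal_disjoint[of ?S] by blast
  moreover have "u \<in> ?S" by (rule image_eqI[of _ _ 0]) auto
  ultimately show False using assms by (auto simp: prime_radical_def)
qed

lemma completely_prime_pos_pow:
  assumes "\<And>a b. a * b \<in> P \<Longrightarrow> a \<in> P \<or> b \<in> P" and "pos_pow u (Suc k) \<in> P"
  shows "u \<in> P"
  using assms(2)
proof (induction k)
  case (Suc k)
  then show ?case using assms(1) by auto
qed simp

section \<open>Ideals containing all commutators\<close>

lemma factor_ring_commutativeI:
  assumes I: "two_sided_ideal I" and "\<And>a b. lie_bracket a b \<in> I"
  shows "factor_ring_commutative I"
proof -
  \<comment> \<open>One inclusion suffices, as \<open>a\<close> and \<open>b\<close> can be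
    exchanged.\<close>
  have le: "(a * b) +o I \<subseteq> (b * a) +o I" for a b
  proof
    fix z assume "z \<in> (a * b) +o I"
    then obtain i where "i \<in> I" "z = a * b + i" by (auto simp: elt_set_plus_def)
    then have "z = b * a + (lie_bracket a b + i)" "lie_bracket a b + i \<in> I"
      using assms(2) two_sided_idealD[OF I] by (auto simp: lie_bracket_def)
    then show "z \<in> (b * a) +o I" by (auto simp: elt_set_plus_def)
  qed
  have "coset_mult I (a +o I) (b +o I) = coset_mult I (b +o I) (a +o I)" for a b
    unfolding coset_mult_cosets[OF I] using le by blast
  then show ?thesis
    by (auto simp: factor_ring_commutative_def factor_ring_carrier_def)
qed

text \<open>A right factor can be moved to the left at the cost of a commutator, which already lies
  in \<open>L\<close>.\<close>

lemma left_ideal_two_sided: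
  assumes L: "left_ideal L" and "\<And>a b. lie_bracket a b \<in> L"
  shows "two_sided_ideal L"
proof -
  have "x * r \<in> L" if "x \<in> L" for x r
  proof -
    have "x * r = r * x + lie_bracket x r" by (simp add: lie_bracket_def)
    then show ?thesis using that assms by (simp add: left_ideal_def add_subgroup_def)
  qed
  then show ?thesis using L by (simp add: left_ideal_def two_sided_ideal_def)
qed

lemma left_ideal_plus:
  assumes "left_ideal A" "left_ideal B"
  shows "left_ideal (A + B)"
  using assms add_subgroup_plus
  by (auto simp: left_ideal_def distrib_left elim!: set_plus_elim intro!: set_plus_intro)

theorem proposition3p1:
  fixes n :: nat
  assumes "n \<ge> 2"
    and "lie_nilpotent TYPE('a::ring) n"
  shows "(\<forall>(P :: 'a set) a b. prime_ideal P \<longrightarrow> a * b \<in> P \<longrightarrow> a \<in> P \<or> b \<in> P) \<and>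
    (prime_radical :: 'a set) = {u. nilpotent_elem u} \<and>
    factor_ring_commutative (prime_radical :: 'a set) \<and>
    (\<forall>L :: 'a set. left_ideal L \<longrightarrow> two_sided_ideal (L + prime_radical)) \<and>
    (\<forall>L :: 'a set. left_ideal L \<longrightarrow> prime_radical \<subseteq> L \<longrightarrow> two_sided_ideal L)"
proof (intro conjI allI impI)
  have comm: "lie_bracket a b \<in> P" if "prime_ideal P" for P :: "'a set" and a b
    using prime_ideal_commutator[of n P] assms that by simp
  then have rad_comm: "lie_bracket a b \<in> prime_radical" for a b :: 'a
    by (simp add: prime_radical_def)
  \<comment> \<open>Every element is central modulo \<open>P\<close>, so the lemma on central
    elements applies to \<open>a\<close>.\<close>
  show prime: "a \<in> P \<or> b \<in> P" if "prime_ideal P" "a * b \<in> P" for P :: "'a set" and a b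
    using prime_ideal_central comm that by blast
  have "u \<in> prime_radical" if nil: "nilpotent_elem u" for u :: 'a
    unfolding prime_radical_def
  proof safe
    fix P :: "'a set" assume P: "prime_ideal P"
    obtain k where "pos_pow u (Suc k) = 0"
      using nil unfolding nilpotent_elem_def One_nat_def by (metis Suc_le_D)
    then have "pos_pow u (Suc k) \<in> P"
      using two_sided_idealD(1)[OF prime_ideal_two_sided[OF P]] by simp
    then show "u \<in> P" using completely_prime_pos_pow prime[OF P] by blast
  qed
  then show "(prime_radical :: 'a set) = {u. nilpotent_elem u}"
    using prime_radical_nilpotent by blast
  show "factor_ring_commutative (prime_radical :: 'a set)"
    using factor_ring_commutativeI two_sided_ideal_prime_radical rad_comm by blast
  show two_sided: "two_sided_ideal L" if "left_ideal L" "prime_radical \<subseteq> L" for L :: "'a set"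
    using left_ideal_two_sided rad_comm that by blast
  fix L :: "'a set" assume L: "left_ideal L"
  \<comment> \<open>The sum \<open>L + prime_radical\<close> is itself a left ideal containing the
    radical, which reduces the claim to the case just shown.\<close>
  have "left_ideal (prime_radical :: 'a set)"
    using two_sided_ideal_prime_radical by (auto simp: left_ideal_def two_sided_ideal_def)
  then have "left_ideal (L + prime_radical)" by (rule left_ideal_plus[OF L])
  moreover have "prime_radical \<subseteq> L + prime_radical"
    using set_plus_intro[of 0 L _ prime_radical] L by (auto simp: left_ideal_def add_subgroup_def)
  ultimately show "two_sided_ideal (L + prime_radical)" by (rule two_sided)
qed

end
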